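(* Let $k\ge 0$ be an integer. There is a polynomial $P_k$ in $n$ of degree exactly $k$ with leading coefficient $\frac{3^k}{k!}$ such that $r_{2n-k}(n)=P_k(n)$ for all sufficiently large integers $n$.
   Context: For integers $n\ge 1$ and $j$, let $r_j(n)$ denote the number of ways to divide a $2\times n$ rectangular strip of $2n$ unit squares (2 rows, $n$ columns) into exactly $j$ pieces by cutting only along edges of the unit squares, each piece being an edge-connected union of unit squares (equivalently, partitions of the vertex set of the ladder graph $P_2\times P_n$ into $j$ blocks each inducing a connected subgraph); $r_j(n)=0$ for $j\le 0$ or $j>2n$. *)

theory Defs
  imports Complex_Main "HOL-Library.Disjoint_Sets" "HOL-Computational_Algebra.Polynomial"
begin

text \<open>Unit squares are pairs (row, column).\<close>

type_synonym cell = "nat \<times> nat"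

definition strip :: "nat \<Rightarrow> cell set" where
  "strip n = {0..<2} \<times> {0..<n}"

definition adjacent :: "cell \<Rightarrow> cell \<Rightarrow> bool" where
  "adjacent x y \<longleftrightarrow>
     (fst x = fst y \<and> (snd y = Suc (snd x) \<or> snd x = Suc (snd y))) \<or>
     (snd x = snd y \<and> (fst y = Suc (fst x) \<or> fst x = Suc (fst y)))"

text \<open>Any two cells of \<open>B\<close> are joined by an edge-path staying inside \<open>B\<close>. The empty set
  satisfies this vacuously; pieces are nonempty because \<^const>\<open>partition_on\<close> requires it.\<close>

definition edge_connected :: "cell set \<Rightarrow> bool" where
  "edge_connected B \<longleftrightarrow>
     (\<forall>x\<in>B. \<forall>y\<in>B. (x, y) \<in> {(u, v). u \<in> B \<and> v \<in> B \<and> adjacent u v}\<^sup>*)"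

definition divisions :: "int \<Rightarrow> nat \<Rightarrow> cell set set set" where
  "divisions j n =
     {P. partition_on (strip n) P \<and> int (card P) = j \<and> (\<forall>B\<in>P. edge_connected B)}"

text \<open>The number of pieces is an integer so that \<open>2 * n - k\<close> is not truncated.\<close>

definition r :: "int \<Rightarrow> nat \<Rightarrow> nat" where
  "r j n = card (divisions j n)"

lemma finite_strip: "finite (strip n)"
  by (simp add: strip_def)

lemma card_strip: "card (strip n) = 2 * n"
  by (simp add: strip_def)

text \<open>In particular, no value of \<^const>\<open>r\<close> comes from the cardinality of an infinite set.\<close>

lemma finite_divisions: "finite (divisions j n)"
proof (rule finite_subset)
  show "divisions j n \<subseteq> Pow (Pow (strip n))"
    by (auto simp: divisions_def partition_on_def)
qed (simp add: finite_strip)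

lemma r_nonpos:
  assumes "n \<ge> 1" and "j \<le> 0"
  shows "r j n = 0"
proof -
  have False if P: "P \<in> divisions j n" for P
  proof -
    have part: "partition_on (strip n) P" and "card P = 0"
      using P assms(2) by (auto simp: divisions_def)
    then have "P = {}"
      using finite_elements[OF finite_strip part] by simp
    with part have "strip n = {}"
      by (simp add: partition_on_def)
    then show False
      using assms(1) by (simp add: strip_def)
  qed
  then have "divisions j n = {}" by blast
  then show ?thesis by (simp add: r_def)
qed

lemma r_large:
  assumes "j > 2 * int n"
  shows "r j n = 0"
proof -
  have False if P: "P \<in> divisions j n" for P
  proof -
    have part: "partition_on (strip n) P" and j: "int (card P) = j"
      using P by (auto simp: divisions_def)
    have "card P \<le> card (strip n)"
    proof (rule card_inj_on_le)
      let ?f = "\<lambda>B. SOME x. x \<in> B"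
      have some: "?f B \<in> B" if "B \<in> P" for B
        using partition_onD3[OF part] that by (metis some_in_eq)
      show "inj_on ?f P"
        using some partition_onD2[OF part] by (intro inj_onI) (metis disjointD disjoint_iff)
      show "?f ` P \<subseteq> strip n"
        using some partition_onD1[OF part] by blast
    qed (rule finite_strip)
    then show False
      using j assms by (simp add: card_strip)
  qed
  then have "divisions j n = {}" by blast
  then show ?thesis by (simp add: r_def)
qed

end

theory Submission
  imports Defs
begin

text \<open>Write the deficiency of a division for its number of cells minus its number of pieces, and let
  \<open>f k n\<close> count the divisions of deficiency \<open>k\<close> of the strip of length \<open>n\<close>. Cutting at the
  last gap between columns crossed by no piece leaves an arbitrary division followed by an irreducible
  one, in which every gap is crossed; hence \<open>f k n = (\<Sum>m i. c m i * f (k - i) (n - m))\<close>, where \<open>c m i\<close>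
  counts irreducible divisions of length \<open>m\<close> and deficiency \<open>i\<close>. These satisfy \<open>m \<le> i + 1\<close>, so the
  sum is finite independently of \<open>n\<close>, and \<open>c 1 0 = 1\<close>, \<open>c 1 1 = 1\<close>, \<open>c 2 1 = 2\<close>. Thus
  \<open>f k (n + 1) - f k n\<close> is \<open>f (k - 1) n + 2 * f (k - 1) (n - 1)\<close> plus shifts of \<open>f j\<close> with
  \<open>j < k - 1\<close>, and induction on \<open>k\<close> gives the polynomial.\<close>

subsection \<open>Eventually polynomial sequences\<close>

text \<open>Only a degree bound is imposed, so \<open>c\<close> may be 0. This makes the class
  closed under sums and lets terms of lower degree be added without disturbing the coefficient of
  interest.\<close>

definition eventually_poly :: "nat \<Rightarrow> real \<Rightarrow> (nat \<Rightarrow> real) \<Rightarrow> bool" where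
  "eventually_poly k c g \<longleftrightarrow>
     (\<exists>P. degree P \<le> k \<and> coeff P k = c \<and> (\<forall>\<^sub>F n in sequentially. g n = poly P (real n)))"

lemma eventually_polyI:
  assumes "degree P \<le> k" "coeff P k = c" "\<forall>\<^sub>F n in sequentially. g n = poly P (real n)"
  shows "eventually_poly k c g"
  using assms unfolding eventually_poly_def by blast

lemma eventually_polyE:
  assumes "eventually_poly k c g"
  obtains P where "degree P \<le> k" "coeff P k = c" "\<forall>\<^sub>F n in sequentially. g n = poly P (real n)"
  using assms unfolding eventually_poly_def by blast

lemma eventually_poly_raise:
  assumes "eventually_poly j c g" "j < k"
  shows "eventually_poly k 0 g"
proof -
  from assms(1) obtain P where "degree P \<le> j" "\<forall>\<^sub>F n in sequentially. g n = poly P (real n)"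
    by (rule eventually_polyE)
  then show ?thesis
    using assms(2) by (intro eventually_polyI[of P]) (auto simp: coeff_eq_0)
qed

lemma eventually_poly_cmult:
  assumes "eventually_poly k c g"
  shows "eventually_poly k (a * c) (\<lambda>n. a * g n)"
proof -
  from assms obtain P where P: "degree P \<le> k" "coeff P k = c"
    and ev: "\<forall>\<^sub>F n in sequentially. g n = poly P (real n)"
    by (rule eventually_polyE)
  show ?thesis
  proof (rule eventually_polyI)
    show "degree (smult a P) \<le> k" using P(1) degree_smult_le[of a P] by linarith
    show "coeff (smult a P) k = a * c" using P(2) by simp
    show "\<forall>\<^sub>F n in sequentially. a * g n = poly (smult a P) (real n)"
      using ev by eventually_elim simp
  qed
qed

lemma eventually_poly_sum:
  assumes "finite A" "\<And>x. x \<in> A \<Longrightarrow> eventually_poly k (c x) (g x)"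
  shows "eventually_poly k (\<Sum>x\<in>A. c x) (\<lambda>n. \<Sum>x\<in>A. g x n)"
proof -
  have "\<exists>P. degree P \<le> k \<and> coeff P k = c x \<and> (\<forall>\<^sub>F n in sequentially. g x n = poly P (real n))"
    if "x \<in> A" for x
    using assms(2)[OF that] by (simp only: eventually_poly_def)
  then obtain P where P: "\<And>x. x \<in> A \<Longrightarrow> degree (P x) \<le> k" "\<And>x. x \<in> A \<Longrightarrow> coeff (P x) k = c x"
    "\<And>x. x \<in> A \<Longrightarrow> \<forall>\<^sub>F n in sequentially. g x n = poly (P x) (real n)"
    by metis
  show ?thesis
  proof (rule eventually_polyI)
    show "degree (\<Sum>x\<in>A. P x) \<le> k" using P(1) by (intro degree_sum_le assms(1))
    show "coeff (\<Sum>x\<in>A. P x) k = (\<Sum>x\<in>A. c x)" using P(2) by (simp add: coeff_sum)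
    have "\<forall>\<^sub>F n in sequentially. \<forall>x\<in>A. g x n = poly (P x) (real n)"
      using P(3) assms(1) by (simp add: eventually_ball_finite_distrib)
    then show "\<forall>\<^sub>F n in sequentially. (\<Sum>x\<in>A. g x n) = poly (\<Sum>x\<in>A. P x) (real n)"
      by eventually_elim (simp add: poly_sum)
  qed
qed

text \<open>Composition with a monic linear polynomial keeps the degree and the leading coefficient,
  so either both sides are leading coefficients or both vanish.\<close>

lemma coeff_pcompose_shift:
  fixes P :: "real poly"
  assumes "degree P \<le> k"
  shows "coeff (pcompose P [:a, 1:]) k = coeff P k"
proof (cases "degree P = k")
  case True
  then show ?thesis
    using lead_coeff_comp[of "[:a, 1:]" P] by (simp add: degree_pcompose)
next
  case False
  then show ?thesis using assms by (simp add: coeff_eq_0 degree_pcompose)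
qed

lemma eventually_poly_shift:
  assumes "eventually_poly k c g"
  shows "eventually_poly k c (\<lambda>n. g (Suc n - m))"
proof -
  from assms obtain P where P: "degree P \<le> k" "coeff P k = c"
    and ev: "\<forall>\<^sub>F n in sequentially. g n = poly P (real n)"
    by (rule eventually_polyE)
  from ev obtain N where N: "\<And>n. n \<ge> N \<Longrightarrow> g n = poly P (real n)"
    unfolding eventually_sequentially by blast
  show ?thesis
  proof (rule eventually_polyI)
    show "degree (pcompose P [:1 - real m, 1:]) \<le> k" using P(1) by (simp add: degree_pcompose)
    show "coeff (pcompose P [:1 - real m, 1:]) k = c" using P by (simp add: coeff_pcompose_shift)
    show "\<forall>\<^sub>F n in sequentially. g (Suc n - m) = poly (pcompose P [:1 - real m, 1:]) (real n)"
      unfolding eventually_sequentially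
    proof (intro exI allI impI)
      \<comment> \<open>This bound keeps \<open>Suc n - m\<close> at least \<open>N\<close> and free
        of truncation.\<close>
      fix n assume "N + m \<le> n"
      then show "g (Suc n - m) = poly (pcompose P [:1 - real m, 1:]) (real n)"
        using N[of "Suc n - m"] by (simp add: poly_pcompose of_nat_diff algebra_simps)
    qed
  qed
qed

text \<open>Composition with \<open>[:1, 1:]\<close> is the shift from x to x + 1. A multiple of the
  next higher power has a forward difference that cancels the top term of \<open>Q\<close>; the
  induction hypothesis treats the remainder.\<close>

lemma poly_antidifference:
  fixes Q :: "real poly"
  assumes "degree Q \<le> d"
  shows "\<exists>P. degree P \<le> Suc d \<and> coeff P (Suc d) = coeff Q d / real (Suc d) \<and> pcompose P [:1, 1:] - P = Q"
  using assms
proof (induction d arbitrary: Q)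
  case (0 Q)
  define R where "R = [:0, coeff Q 0:]"
  have "Q = [:coeff Q 0:]" using 0 by (metis degree_0_id le_zero_eq)
  moreover have "pcompose R [:1, 1:] - R = [:coeff Q 0:]"
    by (simp add: R_def pcompose_pCons)
  ultimately have "pcompose R [:1, 1:] - R = Q" by metis
  moreover have "degree R \<le> Suc 0" "coeff R (Suc 0) = coeff Q 0 / real (Suc 0)"
    by (auto simp: R_def)
  ultimately show ?case by blast
next
  case (Suc d Q)
  define e where "e = Suc d"
  \<comment> \<open>The difference of \<open>x ^ Suc e\<close> has coefficient \<open>Suc e\<close>
    at \<open>x ^ e\<close>, whence the division.\<close>
  define c where "c = coeff Q e / real (Suc e)"
  define R where "R = monom c (Suc e)"
  define D where "D = pcompose R [:1, 1:] - R"
  have R: "R = smult c ([:0, 1:] ^ Suc e)" unfolding R_def by (simp only: monom_altdef)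
  have "pcompose ([:0, 1:] ^ j) [:1, 1:] = ([:1, 1:] :: real poly) ^ j" for j
    by (induction j) (simp_all add: pcompose_mult pcompose_pCons pcompose_1)
  then have D: "D = smult c ([:1, 1:] ^ Suc e) - monom c (Suc e)"
    unfolding D_def by (simp only: R pcompose_smult) (simp only: monom_altdef)
  have deg: "degree ([:1, 1::real:] ^ Suc e) \<le> Suc e"
    using degree_power_le[of "[:1, 1::real:]" "Suc e"] by simp
  \<comment> \<open>Binomial theorem; the subtracted monomial removes exactly the coefficient at
    \<open>Suc e\<close>.\<close>
  have coeff_D: "coeff D i = (if i \<le> e then c * real (Suc e choose i) else 0)" for i
  proof (cases "i \<le> Suc e")
    case True
    then show ?thesis
      unfolding D coeff_diff coeff_smult coeff_linear_poly_power[OF True] by (auto simp: le_Suc_eq)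
  next
    case False
    then have "coeff ([:1, 1::real:] ^ Suc e) i = 0" using deg by (intro coeff_eq_0) simp
    then show ?thesis using False unfolding D coeff_diff coeff_smult by simp
  qed
  have "degree (Q - D) \<le> d"
  proof (rule degree_le, intro allI impI)
    fix i assume "d < i"
    then consider "i = e" | "e < i" unfolding e_def by linarith
    then show "coeff (Q - D) i = 0"
    proof cases
      case 1
      then show ?thesis by (simp add: coeff_D c_def del: binomial_Suc_Suc)
    next
      case 2
      then show ?thesis using Suc.prems by (simp add: coeff_D coeff_eq_0 e_def)
    qed
  qed
  from Suc.IH[OF this] obtain P where P: "degree P \<le> Suc d" "pcompose P [:1, 1:] - P = Q - D"
    by blast
  have "degree (P + R) \<le> Suc e"
    using P(1) degree_monom_le[of c "Suc e"] by (intro degree_add_le) (auto simp: R_def e_def)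
  moreover have "coeff (P + R) (Suc e) = c"
    using P(1) by (simp add: R_def e_def coeff_eq_0)
  moreover have "pcompose (P + R) [:1, 1:] - (P + R) = Q"
    using P(2) unfolding D_def by (simp add: pcompose_add algebra_simps)
  ultimately show ?case unfolding c_def e_def by blast
qed

text \<open>Since their increments agree from \<open>N\<close> on, \<open>g\<close> and
  \<open>P\<close> differ by a constant there; adding it touches only the coefficient at 0, never
  the one at \<open>Suc k\<close>.\<close>

lemma eventually_poly_antidifference:
  assumes "eventually_poly k c (\<lambda>n. g (Suc n) - g n)"
  shows "eventually_poly (Suc k) (c / real (Suc k)) g"
proof -
  from assms obtain Q where Q: "degree Q \<le> k" "coeff Q k = c"
    and ev: "\<forall>\<^sub>F n in sequentially. g (Suc n) - g n = poly Q (real n)"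
    by (rule eventually_polyE)
  from ev obtain N where N: "\<And>n. n \<ge> N \<Longrightarrow> g (Suc n) - g n = poly Q (real n)"
    unfolding eventually_sequentially by blast
  obtain P where P: "degree P \<le> Suc k" "coeff P (Suc k) = c / real (Suc k)"
    and diff: "pcompose P [:1, 1:] - P = Q"
    using poly_antidifference[OF Q(1)] Q(2) by blast
  have step: "poly P (real (Suc n)) - poly P (real n) = poly Q (real n)" for n
    unfolding diff[symmetric] by (simp add: poly_pcompose algebra_simps)
  have const: "g n - poly P (real n) = g N - poly P (real N)" if "N \<le> n" for n
    using that
  proof (induction n rule: dec_induct)
    case (step n)
    then show ?case using N[of n] \<open>poly P (real (Suc n)) - poly P (real n) = poly Q (real n)\<close> by linarith
  qed simp
  show ?thesis
  proof (rule eventually_polyI)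
    let ?C = "[:g N - poly P (real N):]"
    show "degree (P + ?C) \<le> Suc k" using P(1) by (intro degree_add_le) auto
    show "coeff (P + ?C) (Suc k) = c / real (Suc k)" using P(2) by simp
    show "\<forall>\<^sub>F n in sequentially. g n = poly (P + ?C) (real n)"
      unfolding eventually_sequentially using const by (intro exI[of _ N]) (simp add: algebra_simps)
  qed
qed

subsection \<open>Connected partitions of a segment of the strip\<close>

text \<open>The deficiency is a sum over pieces, a piece \<open>B\<close> contributing
  \<open>card B - 1\<close>. Blocks are nonempty, so the truncated subtraction is exact.\<close>

lemma sum_card_minus_1_partition:
  assumes "finite V" "partition_on V P"
  shows "(\<Sum>B\<in>P. card B - 1) + card P = card V"
proof -
  have fin: "finite B" if "B \<in> P" for B
    using assms that by (metis Sup_upper finite_subset partition_onD1)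
  have "card B \<ge> 1" if "B \<in> P" for B
    using fin[OF that] that partition_onD3[OF assms(2)]
    by (metis One_nat_def Suc_leI card_gt_0_iff)
  then have "(\<Sum>B\<in>P. card B - 1) + (\<Sum>B\<in>P. 1) = (\<Sum>B\<in>P. card B)"
    unfolding sum.distrib[symmetric] by (intro sum.cong refl le_add_diff_inverse2)
  then show ?thesis
    using product_partition[OF assms(2) fin] by simp
qed

text \<open>Identifies the divisions of deficiency 0 and 1, where at most one piece can be larger
  than a cell.\<close>

lemma partition_singletons_except:
  assumes "partition_on V P" "B \<in> P" "\<And>C. C \<in> P \<Longrightarrow> C \<noteq> B \<Longrightarrow> card C = 1"
  shows "P = insert B ((\<lambda>x. {x}) ` (V - B))"
proof (intro equalityI subsetI)
  fix C assume C: "C \<in> P"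
  show "C \<in> insert B ((\<lambda>x. {x}) ` (V - B))"
  proof (cases "C = B")
    case False
    then obtain x where x: "C = {x}"
      using assms(3)[OF C] by (auto simp: card_1_singleton_iff)
    have "C \<inter> B = {}"
      using False C assms(2) partition_onD2[OF assms(1)] unfolding disjoint_def by blast
    then have "x \<notin> B" using x by simp
    moreover have "x \<in> V" using C x partition_onD1[OF assms(1)] by auto
    ultimately show ?thesis using x by auto
  qed simp
next
  fix C assume "C \<in> insert B ((\<lambda>x. {x}) ` (V - B))"
  then consider "C = B" | x where "C = {x}" "x \<in> V" "x \<notin> B" by auto
  then show "C \<in> P"
  proof cases
    case 2
    then obtain D where D: "D \<in> P" "x \<in> D" using partition_onD1[OF assms(1)] by auto
    then have "card D = 1" using assms(3) 2 by auto
    then have "D = {x}" using D by (auto simp: card_1_singleton_iff)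
    then show ?thesis using D 2 by simp
  qed (use assms(2) in simp)
qed

section \<open>Edge-connected sets of cells\<close>

lemma edge_connected_singleton: "edge_connected {x}"
  by (simp add: edge_connected_def)

lemma adjacent_sym: "adjacent x y \<longleftrightarrow> adjacent y x"
  by (auto simp: adjacent_def)

lemma edge_connected_doubleton:
  assumes "adjacent x y"
  shows "edge_connected {x, y}"
  using assms adjacent_sym[of x y] unfolding edge_connected_def by (auto intro!: r_into_rtrancl)

text \<open>A step changes the column by at most one, so a path from the left of gap
  \<open>g\<close> to its right must step horizontally from column \<open>g - 1\<close> to column
  \<open>g\<close>.\<close>

lemma edge_connected_crossing:
  assumes "edge_connected B" "x \<in> B" "y \<in> B" "snd x < g" "g \<le> snd y"
  obtains i where "(i, g - 1) \<in> B" "(i, g) \<in> B"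
proof -
  have "(x, y) \<in> {(u, v). u \<in> B \<and> v \<in> B \<and> adjacent u v}\<^sup>*"
    using assms unfolding edge_connected_def by blast
  then have "g \<le> snd y \<Longrightarrow> \<exists>i. (i, g - 1) \<in> B \<and> (i, g) \<in> B"
  proof (induction rule: rtrancl_induct)
    case base
    then show ?case using assms(4) by simp
  next
    case (step y z)
    show ?case
    proof (cases "g \<le> snd y")
      \<comment> \<open>The step from \<open>y\<close> to \<open>z\<close> is the one that passes
        the gap.\<close>
      case False
      then have "fst y = fst z" "snd y = g - 1" "snd z = g"
        using step(2,4) by (auto simp: adjacent_def)
      then have "(fst z, g - 1) \<in> B" "(fst z, g) \<in> B"
        using step(2) by (metis (mono_tags, lifting) case_prodD mem_Collect_eq prod.collapse)+
      then show ?thesis by blast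
    qed (use step in simp)
  qed
  then show thesis using that assms(5) by blast
qed

text \<open>A nonempty block of \<open>Q\<close> cannot lie inside \<open>A\<close>, so
  \<open>P\<close> can be read off from the union. This gives the injectivity of gluing.\<close>

lemma partition_on_Un_blocks:
  assumes "partition_on A P" "partition_on B Q" "A \<inter> B = {}"
  shows "{C \<in> P \<union> Q. C \<subseteq> A} = P"
proof (intro equalityI subsetI)
  fix C assume C: "C \<in> {C \<in> P \<union> Q. C \<subseteq> A}"
  show "C \<in> P"
  proof (rule ccontr)
    assume "C \<notin> P"
    then have "C \<in> Q" using C by simp
    then have "C \<subseteq> B" "C \<noteq> {}" using assms(2) by (auto simp: partition_on_def)
    then show False using C assms(3) by blast
  qed
qed (use assms(1) in \<open>auto simp: partition_on_def\<close>)

section \<open>Divisions of segments of columns, graded by deficiency\<close>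

definition segment :: "nat \<Rightarrow> nat \<Rightarrow> cell set" where
  "segment a b = {0..<2} \<times> {a..<b}"

lemma finite_segment: "finite (segment a b)"
  by (simp add: segment_def)

lemma card_segment: "card (segment a b) = 2 * (b - a)"
  by (simp add: segment_def)

text \<open>\<open>k\<close> is the deficiency, stated additively to avoid truncation. The left end
  \<open>a\<close> is free so that the part right of a cut can stay in place.\<close>

definition segment_divisions :: "nat \<Rightarrow> nat \<Rightarrow> nat \<Rightarrow> cell set set set" where
  "segment_divisions a b k =
     {P. partition_on (segment a b) P \<and> card P + k = 2 * (b - a) \<and> (\<forall>B\<in>P. edge_connected B)}"

text \<open>Gap \<open>g\<close> lies between columns \<open>g - 1\<close> and \<open>g\<close>. The
  two cells need not be neighbours; for connected pieces \<open>edge_connected_crossing\<close>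
  provides neighbouring ones.\<close>

definition crosses :: "cell set set \<Rightarrow> nat \<Rightarrow> bool" where
  "crosses P g \<longleftrightarrow> (\<exists>B\<in>P. \<exists>u\<in>B. \<exists>v\<in>B. snd u < g \<and> g \<le> snd v)"

definition irreducible_divisions :: "nat \<Rightarrow> nat \<Rightarrow> nat \<Rightarrow> cell set set set" where
  "irreducible_divisions a b k = {P \<in> segment_divisions a b k. \<forall>g. a < g \<and> g < b \<longrightarrow> crosses P g}"

lemma finite_segment_divisions: "finite (segment_divisions a b k)"
  by (rule finite_subset[OF _ finitely_many_partition_on[OF finite_segment[of a b]]])
    (auto simp: segment_divisions_def)

lemma finite_irreducible_divisions: "finite (irreducible_divisions a b k)"
  by (simp add: irreducible_divisions_def finite_segment_divisions)

lemma r_eq_card_segment_divisions: "r (2 * int n - int k) n = card (segment_divisions 0 n k)"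
proof -
  have "int c = 2 * int n - int k \<longleftrightarrow> c + k = 2 * n" for c by linarith
  then have "divisions (2 * int n - int k) n = segment_divisions 0 n k"
    by (simp add: divisions_def segment_divisions_def strip_def segment_def)
  then show ?thesis by (simp add: r_def)
qed

lemma partition_blockD:
  assumes "partition_on (segment a b) P" "B \<in> P"
  shows "B \<subseteq> segment a b" "B \<noteq> {}" "finite B"
proof -
  show "B \<subseteq> segment a b" "B \<noteq> {}"
    using assms partition_onD1 partition_onD3 by blast+
  then show "finite B" using finite_segment finite_subset by blast
qed

lemma sum_segment_division:
  assumes "P \<in> segment_divisions a b k"
  shows "(\<Sum>B\<in>P. card B - 1) = k" "finite P"
proof -
  have P: "partition_on (segment a b) P" "card P + k = 2 * (b - a)"
    using assms by (auto simp: segment_divisions_def)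
  show "(\<Sum>B\<in>P. card B - 1) = k"
    using sum_card_minus_1_partition[OF finite_segment P(1)] P(2) by (simp add: card_segment)
  show "finite P" by (rule finite_elements[OF finite_segment P(1)])
qed

text \<open>A connected piece crossing a gap has a cell just to the right of it, so a piece crosses fewer
  gaps than it has cells.\<close>

lemma irreducible_divisions_length_le:
  assumes "P \<in> irreducible_divisions a b k"
  shows "b - a \<le> k + 1"
proof -
  have P: "P \<in> segment_divisions a b k" and cr: "\<And>g. a < g \<Longrightarrow> g < b \<Longrightarrow> crosses P g"
    using assms by (auto simp: irreducible_divisions_def)
  have part: "partition_on (segment a b) P" and conn: "\<And>B. B \<in> P \<Longrightarrow> edge_connected B"
    using P by (auto simp: segment_divisions_def)
  define G where "G B = {g. crosses {B} g}" for B
  have G: "finite (G B) \<and> card (G B) \<le> card B - 1" if B: "B \<in> P" for B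
  proof -
    have fin: "finite (snd ` B)" and ne: "snd ` B \<noteq> {}"
      using partition_blockD[OF part B] by auto
    \<comment> \<open>Gap \<open>g\<close> is identified with the column to its right; the leftmost
      column of \<open>B\<close> is never such a column.\<close>
    have "G B \<subseteq> snd ` B - {Min (snd ` B)}"
    proof
      fix g assume "g \<in> G B"
      then obtain u v where uv: "u \<in> B" "v \<in> B" "snd u < g" "g \<le> snd v"
        by (auto simp: G_def crosses_def)
      obtain i where "(i, g) \<in> B"
        by (rule edge_connected_crossing[OF conn[OF B] uv])
      moreover have "Min (snd ` B) < g"
        using uv fin by (meson Min_le imageI le_less_trans)
      ultimately show "g \<in> snd ` B - {Min (snd ` B)}" by force
    qed
    moreover have "card (snd ` B - {Min (snd ` B)}) = card (snd ` B) - 1"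
      using Min_in[OF fin ne] by simp
    moreover have "card (snd ` B) \<le> card B"
      using partition_blockD[OF part B] by (simp add: card_image_le)
    ultimately show ?thesis
      using fin by (metis (no_types, lifting) card_mono diff_le_mono dual_order.trans finite_Diff finite_subset)
  qed
  have fP: "finite P" using sum_segment_division[OF P] by simp
  \<comment> \<open>All interior gaps are crossed, while the pieces together cross at most
    \<open>k\<close> gaps.\<close>
  have "{a<..<b} \<subseteq> (\<Union>B\<in>P. G B)"
    using cr by (auto simp: G_def crosses_def)
  then have "card {a<..<b} \<le> card (\<Union>B\<in>P. G B)"
    using G fP by (intro card_mono) auto
  also have "\<dots> \<le> (\<Sum>B\<in>P. card (G B))"
    by (rule card_UN_le[OF fP])
  also have "\<dots> \<le> (\<Sum>B\<in>P. card B - 1)"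
    using G by (intro sum_mono) auto
  also have "\<dots> = k" using sum_segment_division[OF P] by simp
  finally show ?thesis by simp
qed

text \<open>The shift is by \<open>p - q\<close>, so one statement covers both directions. The
  condition on \<open>q\<close> keeps the subtraction exact for every column of the segment.\<close>

lemma irreducible_divisions_translate:
  assumes P: "P \<in> irreducible_divisions a b k" and q: "q \<le> a + p"
  defines "f \<equiv> \<lambda>x :: cell. (fst x, snd x + p - q)"
  shows "(`) f ` P \<in> irreducible_divisions (a + p - q) (b + p - q) k"
proof (cases "a \<le> b")
  \<comment> \<open>With \<open>a > b\<close> the right end could be truncated, but both segments
    are empty.\<close>
  case False
  then have "segment a b = {}" "segment (a + p - q) (b + p - q) = {}" "2 * (b - a) = 0"
    "2 * (b + p - q - (a + p - q)) = 0"
    by (auto simp: segment_def)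
  then show ?thesis
    using P False by (auto simp: irreducible_divisions_def segment_divisions_def partition_on_empty)
next
  case True
  have part: "partition_on (segment a b) P" and conn: "\<And>B. B \<in> P \<Longrightarrow> edge_connected B"
    and card: "card P + k = 2 * (b - a)" and cr: "\<And>g. a < g \<Longrightarrow> g < b \<Longrightarrow> crosses P g"
    using P by (auto simp: segment_divisions_def irreducible_divisions_def)
  have inj: "inj_on f (segment a b)"
    using q by (auto simp: f_def segment_def inj_on_def)
  have img: "f ` segment a b = segment (a + p - q) (b + p - q)"
  proof (intro equalityI subsetI)
    fix y assume y: "y \<in> segment (a + p - q) (b + p - q)"
    then have "y = f (fst y, snd y + q - p)" "(fst y, snd y + q - p) \<in> segment a b"
      using q by (auto simp: f_def segment_def)
    then show "y \<in> f ` segment a b" by blast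
  qed (use q in \<open>auto simp: f_def segment_def\<close>)
  have sub: "\<And>B. B \<in> P \<Longrightarrow> B \<subseteq> segment a b" using partition_blockD[OF part] by blast
  have "{} \<notin> P" using part by (simp add: partition_on_def)
  then have "partition_on (segment (a + p - q) (b + p - q)) ((`) f ` P)"
    using partition_on_inj_image[OF part inj] img by (metis (no_types, lifting) Diff_empty Diff_insert0 image_iff image_is_empty)
  moreover have "card ((`) f ` P) = card P"
    using inj_on_image[of f P] inj part by (intro card_image) (simp add: partition_on_def)
  moreover have "edge_connected (f ` B)" if B: "B \<in> P" for B
  proof -
    have adj: "adjacent (f u) (f v)" if "u \<in> B" "v \<in> B" "adjacent u v" for u v
    proof -
      have "a \<le> snd u" "a \<le> snd v" using sub[OF B] that(1,2) by (auto simp: segment_def)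
      then show ?thesis using that(3) q by (auto simp: f_def adjacent_def)
    qed
    have "(f u, f v) \<in> {(u, v). u \<in> f ` B \<and> v \<in> f ` B \<and> adjacent u v}\<^sup>*"
      if "u \<in> B" "v \<in> B" for u v
    proof -
      have "(u, v) \<in> {(u, v). u \<in> B \<and> v \<in> B \<and> adjacent u v}\<^sup>*"
        using conn[OF B] that by (auto simp: edge_connected_def)
      then show ?thesis
      proof (induction rule: rtrancl_induct)
        case (step y z)
        then have "(f y, f z) \<in> {(u, v). u \<in> f ` B \<and> v \<in> f ` B \<and> adjacent u v}"
          using adj[of y z] by blast
        then show ?case using step.IH by (rule rtrancl_into_rtrancl[rotated])
      qed simp
    qed
    then show ?thesis by (auto simp: edge_connected_def)
  qed
  moreover have "crosses ((`) f ` P) g" if "a + p - q < g" "g < b + p - q" for g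
  proof -
    \<comment> \<open>\<open>g + q - p\<close> is the gap that the shift carries to
      \<open>g\<close>.\<close>
    have "crosses P (g + q - p)" using that q by (intro cr) auto
    then obtain B u v where B: "B \<in> P" "u \<in> B" "v \<in> B" "snd u < g + q - p" "g + q - p \<le> snd v"
      by (auto simp: crosses_def)
    then have "snd (f u) < g" "g \<le> snd (f v)"
      using sub[OF B(1)] q that by (auto simp: f_def segment_def)
    then show ?thesis using B(1-3) by (auto simp: crosses_def)
  qed
  moreover have "b + p - q - (a + p - q) = b - a" using True q by auto
  ultimately show ?thesis
    using card by (auto simp: irreducible_divisions_def segment_divisions_def)
qed

lemma card_irreducible_divisions_translate:
  "card (irreducible_divisions a (a + m) k) = card (irreducible_divisions 0 m k)"
proof -
  \<comment> \<open>The idle \<open>- 0\<close> and \<open>+ 0\<close> match the form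
    \<open>snd x + p - q\<close> of the translation lemma.\<close>
  let ?up = "\<lambda>x :: cell. (fst x, snd x + a - 0)" and ?dn = "\<lambda>x :: cell. (fst x, snd x + 0 - a)"
  have "bij_betw ((`) ((`) ?up)) (irreducible_divisions 0 m k) (irreducible_divisions a (a + m) k)"
  proof (rule bij_betw_byWitness[where f' = "(`) ((`) ?dn)"])
    show "\<forall>P\<in>irreducible_divisions 0 m k. (`) ?dn ` ((`) ?up ` P) = P"
      by (simp add: image_image)
    show "\<forall>P\<in>irreducible_divisions a (a + m) k. (`) ?up ` ((`) ?dn ` P) = P"
    proof
      fix P assume "P \<in> irreducible_divisions a (a + m) k"
      then have "partition_on (segment a (a + m)) P"
        by (simp add: irreducible_divisions_def segment_divisions_def)
      from partition_blockD(1)[OF this] have "?up ` ?dn ` B = B" if "B \<in> P" for B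
        using that by (force simp: segment_def image_iff)
      then show "(`) ?up ` ((`) ?dn ` P) = P" by (simp add: image_image)
    qed
    show "(`) ((`) ?up) ` irreducible_divisions 0 m k \<subseteq> irreducible_divisions a (a + m) k"
      using irreducible_divisions_translate[of _ 0 m k 0 a] by (force simp: add.commute)
    show "(`) ((`) ?dn) ` irreducible_divisions a (a + m) k \<subseteq> irreducible_divisions 0 m k"
      using irreducible_divisions_translate[of _ a "a + m" k a 0] by force
  qed
  then show ?thesis by (simp add: bij_betw_same_card)
qed

section \<open>Gluing and cutting at an uncrossed gap\<close>

lemma segment_division_Un:
  assumes "P \<in> segment_divisions a b i" "Q \<in> segment_divisions b c j" "a \<le> b" "b \<le> c"
  shows "P \<union> Q \<in> segment_divisions a c (i + j)"
proof -
  have P: "partition_on (segment a b) P" and Q: "partition_on (segment b c) Q"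
    using assms by (auto simp: segment_divisions_def)
  have un: "segment a b \<union> segment b c = segment a c"
    using assms(3,4) by (auto simp: segment_def)
  have sep: "p \<inter> q = {}" if "p \<in> P" "q \<in> Q" for p q
    using partition_blockD(1)[OF P that(1)] partition_blockD(1)[OF Q that(2)]
    by (force simp: segment_def)
  have part: "partition_on (segment a c) (P \<union> Q)"
  proof (rule partition_onI)
    show "\<Union>(P \<union> Q) = segment a c" "{} \<notin> P \<union> Q"
      using P Q un by (auto simp: partition_on_def)
    show "disjnt p q" if "p \<in> P \<union> Q" "q \<in> P \<union> Q" "p \<noteq> q" for p q
    proof -
      have "disjnt p q" if "p \<in> P" "q \<in> P"
        using pairwiseD[OF partition_onD2[OF P] that \<open>p \<noteq> q\<close>] .
      moreover have "disjnt p q" if "p \<in> Q" "q \<in> Q"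
        using pairwiseD[OF partition_onD2[OF Q] that \<open>p \<noteq> q\<close>] .
      moreover have "disjnt p q" if "p \<in> P" "q \<in> Q"
        using sep[OF that] by (simp add: disjnt_def)
      moreover have "disjnt p q" if "p \<in> Q" "q \<in> P"
        using sep[OF that(2,1)] by (simp add: disjnt_def Int_commute)
      ultimately show ?thesis using that(1,2) by blast
    qed
  qed
  \<comment> \<open>A common block would lie on both sides of \<open>b\<close>, hence be
    empty.\<close>
  have "P \<inter> Q = {}"
  proof (rule ccontr)
    assume "P \<inter> Q \<noteq> {}"
    then obtain p where "p \<in> P" "p \<in> Q" by blast
    then have "p = {}" using sep[of p p] by simp
    then show False using partition_onD3[OF P] \<open>p \<in> P\<close> by simp
  qed
  then have cards: "card (P \<union> Q) = card P + card Q"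
    by (rule card_Un_disjoint[OF sum_segment_division(2)[OF assms(1)] sum_segment_division(2)[OF assms(2)]])
  have "card (P \<union> Q) + (i + j) = 2 * (c - a)"
  proof -
    have "card P + i = 2 * (b - a)" "card Q + j = 2 * (c - b)"
      using assms(1,2) unfolding segment_divisions_def by blast+
    then show ?thesis using cards assms(3,4) by linarith
  qed
  moreover have "\<forall>B\<in>P \<union> Q. edge_connected B"
    using assms(1,2) unfolding segment_divisions_def by blast
  ultimately show ?thesis
    using part unfolding segment_divisions_def by simp
qed

text \<open>If nothing crosses \<open>b\<close>, no piece has cells on both sides, so the pieces
  sort into two divisions.\<close>

lemma segment_division_split:
  assumes P: "P \<in> segment_divisions a c k" and "a \<le> b" "b \<le> c" and cut: "\<not> crosses P b"
  obtains i j P1 P2 where "P1 \<in> segment_divisions a b i" "P2 \<in> segment_divisions b c j"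
    "P = P1 \<union> P2" "k = i + j"
proof -
  have part: "partition_on (segment a c) P" and conn: "\<And>B. B \<in> P \<Longrightarrow> edge_connected B"
    and card: "card P + k = 2 * (c - a)"
    using P by (auto simp: segment_divisions_def)
  define P1 where "P1 = {B \<in> P. B \<subseteq> segment a b}"
  define P2 where "P2 = {B \<in> P. B \<subseteq> segment b c}"
  have un: "segment a b \<union> segment b c = segment a c"
    using assms(2,3) by (auto simp: segment_def)
  have P12: "P = P1 \<union> P2"
  proof -
    have "B \<subseteq> segment a b \<or> B \<subseteq> segment b c" if B: "B \<in> P" for B
    proof (rule ccontr)
      assume "\<not> ?thesis"
      then obtain u v where uv: "u \<in> B" "u \<notin> segment b c" "v \<in> B" "v \<notin> segment a b" by blast
      then have "u \<in> segment a c" "v \<in> segment a c" using partition_blockD(1)[OF part B] by blast+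
      with uv have "snd u < b" "b \<le> snd v" by (cases u; cases v; simp add: segment_def)+
      then show False using cut B uv(1,3) unfolding crosses_def by blast
    qed
    then show ?thesis unfolding P1_def P2_def by blast
  qed
  have disj: "segment a b \<inter> segment b c = {}" by (auto simp: segment_def)
  have U: "\<Union>P1 \<subseteq> segment a b" "\<Union>P2 \<subseteq> segment b c" "\<Union>P1 \<union> \<Union>P2 = segment a c"
  proof -
    have "\<Union>P1 \<union> \<Union>P2 = \<Union>P" unfolding Union_Un_distrib[symmetric] P12[symmetric] ..
    then show "\<Union>P1 \<union> \<Union>P2 = segment a c" using partition_onD1[OF part] by simp
  qed (unfold P1_def P2_def, blast+)
  have parts: "partition_on (segment a b) P1" "partition_on (segment b c) P2"
  proof -
    have "\<Union>P1 = segment a b" "\<Union>P2 = segment b c"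
      using U un disj by blast+
    moreover have "disjoint P1" "disjoint P2"
      by (rule pairwise_subset[OF partition_onD2[OF part]], simp add: P1_def P2_def)+
    moreover have "{} \<notin> P1" "{} \<notin> P2"
      using partition_onD3[OF part] by (simp_all add: P1_def P2_def)
    ultimately show "partition_on (segment a b) P1" "partition_on (segment b c) P2"
      by (simp_all add: partition_on_def)
  qed
  note part1 = parts(1) and part2 = parts(2)
  \<comment> \<open>The deficiencies are read off from the pieces; that they add up to
    \<open>k\<close> follows by gluing the parts back together.\<close>
  define i where "i = (\<Sum>B\<in>P1. card B - 1)"
  define j where "j = (\<Sum>B\<in>P2. card B - 1)"
  have division: "P1 \<in> segment_divisions a b i" "P2 \<in> segment_divisions b c j"
  proof -
    have "card P1 + i = 2 * (b - a)" "card P2 + j = 2 * (c - b)"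
      unfolding i_def j_def card_segment[symmetric]
        sum_card_minus_1_partition[OF finite_segment part1, symmetric]
        sum_card_minus_1_partition[OF finite_segment part2, symmetric]
      by (rule add.commute)+
    moreover have "\<forall>B\<in>P1. edge_connected B" "\<forall>B\<in>P2. edge_connected B"
      using conn by (simp_all add: P1_def P2_def)
    ultimately show "P1 \<in> segment_divisions a b i" "P2 \<in> segment_divisions b c j"
      using part1 part2 unfolding segment_divisions_def by blast+
  qed
  have "card P + (i + j) = 2 * (c - a)"
    using segment_division_Un[OF division assms(2,3)] unfolding segment_divisions_def P12[symmetric] by simp
  then have "k = i + j" using card by linarith
  then show thesis by (rule that[OF division P12])
qed

lemma crosses_Un: "crosses (P \<union> Q) g \<longleftrightarrow> crosses P g \<or> crosses Q g"
  by (auto simp: crosses_def)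

lemma not_crosses_segment_division:
  assumes "P \<in> segment_divisions a b k" "g \<le> a \<or> b \<le> g"
  shows "\<not> crosses P g"
proof -
  have "partition_on (segment a b) P" using assms(1) by (simp add: segment_divisions_def)
  from partition_blockD(1)[OF this] show ?thesis
    using assms(2) by (fastforce simp: crosses_def segment_def)
qed

text \<open>\<open>a\<close> is the last uncrossed gap and \<open>i\<close> the deficiency of the
  irreducible part to its right; gluing is then a bijection onto all divisions.\<close>

lemma card_segment_divisions_rec:
  assumes "n > 0"
  shows "card (segment_divisions 0 n k) =
    (\<Sum>a<n. \<Sum>i\<le>k. card (segment_divisions 0 a (k - i)) * card (irreducible_divisions 0 (n - a) i))"
proof -
  define S where "S = (SIGMA (a, i):{..<n} \<times> {..k}.
    segment_divisions 0 a (k - i) \<times> irreducible_divisions a n i)"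
  define f where "f = (\<lambda>((a :: nat, i :: nat), P :: cell set set, Q). P \<union> Q)"
  have img: "f ` S = segment_divisions 0 n k"
  proof (intro equalityI subsetI)
    fix R assume "R \<in> f ` S"
    then obtain a i P Q where "a < n" "i \<le> k" "P \<in> segment_divisions 0 a (k - i)"
      "Q \<in> irreducible_divisions a n i" "R = P \<union> Q"
      by (auto simp: S_def f_def)
    then show "R \<in> segment_divisions 0 n k"
      using segment_division_Un[of P 0 a "k - i" Q n i] by (simp add: irreducible_divisions_def)
  next
    fix R assume R: "R \<in> segment_divisions 0 n k"
    \<comment> \<open>Gap 0 counts as uncrossed since no column lies left of it;
      \<open>a = 0\<close> below is the case of an irreducible \<open>R\<close>.\<close>
    define G where "G = {g. g < n \<and> \<not> crosses R g}"
    have G: "finite G" "0 \<in> G"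
      using assms by (auto simp: crosses_def G_def)
    define a where "a = Max G"
    have "a \<in> G" unfolding a_def using G by (intro Max_in) auto
    then have a: "a < n" "\<not> crosses R a" by (auto simp: G_def)
    have max: "crosses R g" if "a < g" "g < n" for g
    proof (rule ccontr)
      assume "\<not> crosses R g"
      then have "g \<le> a" unfolding a_def using that G(1) by (intro Max_ge) (auto simp: G_def)
      then show False using that by simp
    qed
    obtain j i P Q where PQ: "P \<in> segment_divisions 0 a j" "Q \<in> segment_divisions a n i"
      "R = P \<union> Q" "k = j + i"
      by (rule segment_division_split[OF R _ _ a(2)]) (use a(1) in auto)
    have "Q \<in> irreducible_divisions a n i"
      using PQ max not_crosses_segment_division[OF PQ(1)]
      by (auto simp: irreducible_divisions_def crosses_Un)
    then have "((a, i), P, Q) \<in> S" using PQ a by (auto simp: S_def)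
    moreover have "R = f ((a, i), P, Q)" using PQ by (simp add: f_def)
    ultimately show "R \<in> f ` S" by (rule rev_image_eqI)
  qed
  have inj: "inj_on f S"
  proof (rule inj_onI)
    fix s t assume s: "s \<in> S" and t: "t \<in> S" and eq: "f s = f t"
    obtain a i P Q where sv: "s = ((a, i), P, Q)" by (metis prod.exhaust_sel)
    obtain b j P' Q' where tv: "t = ((b, j), P', Q')" by (metis prod.exhaust_sel)
    have P: "a < n" "P \<in> segment_divisions 0 a (k - i)" "Q \<in> irreducible_divisions a n i"
      using s sv by (auto simp: S_def)
    have P': "b < n" "P' \<in> segment_divisions 0 b (k - j)" "Q' \<in> irreducible_divisions b n j"
      using t tv by (auto simp: S_def)
    have Q: "Q \<in> segment_divisions a n i" "Q' \<in> segment_divisions b n j"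
      using P P' by (auto simp: irreducible_divisions_def)
    have un: "P \<union> Q = P' \<union> Q'" using eq sv tv by (simp add: f_def)
    have noncr: "\<not> crosses (P \<union> Q) a" "\<not> crosses (P' \<union> Q') b"
      using not_crosses_segment_division P(2) P'(2) Q by (auto simp: crosses_Un)
    \<comment> \<open>The larger of two distinct cuts would be an interior gap of the other
      irreducible part, hence crossed, yet each union leaves its own cut uncrossed.\<close>
    have ab: "a = b"
    proof (rule ccontr)
      assume "a \<noteq> b"
      then consider "a < b" | "b < a" by linarith
      then show False
      proof cases
        case 1
        then have "crosses (P \<union> Q) b" using P P' by (auto simp: irreducible_divisions_def crosses_Un)
        then show False using noncr un by simp
      next
        case 2
        then have "crosses (P' \<union> Q') a" using P P' by (auto simp: irreducible_divisions_def crosses_Un)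
        then show False using noncr un by simp
      qed
    qed
    have parts: "partition_on (segment 0 a) P" "partition_on (segment a n) Q"
      "partition_on (segment 0 a) P'" "partition_on (segment a n) Q'"
      using P P' Q ab by (auto simp: segment_divisions_def)
    have disj: "segment 0 a \<inter> segment a n = {}" by (auto simp: segment_def)
    have "P = P'"
      using partition_on_Un_blocks[OF parts(1,2) disj] partition_on_Un_blocks[OF parts(3,4) disj] un
      by (simp only:)
    moreover have "Q = Q'"
      using partition_on_Un_blocks[OF parts(2,1)] partition_on_Un_blocks[OF parts(4,3)] un disj
      by (simp only: Un_commute Int_commute)
    moreover have "i = j"
      using sum_segment_division(1)[OF Q(1)] sum_segment_division(1)[OF Q(2)] \<open>Q = Q'\<close> by simp
    ultimately show "s = t" using sv tv ab by simp
  qed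
  have "card (segment_divisions 0 n k) = card S"
    using card_image[OF inj] img by simp
  also have "\<dots> = (\<Sum>(a, i)\<in>{..<n} \<times> {..k}. card (segment_divisions 0 a (k - i) \<times> irreducible_divisions a n i))"
    unfolding S_def by (subst card_SigmaI)
      (auto simp: finite_segment_divisions finite_irreducible_divisions case_prod_unfold intro!: sum.cong)
  also have "\<dots> = (\<Sum>a<n. \<Sum>i\<le>k. card (segment_divisions 0 a (k - i)) * card (irreducible_divisions a n i))"
    by (simp only: sum.cartesian_product card_cartesian_product)
  also have "\<dots> = (\<Sum>a<n. \<Sum>i\<le>k. card (segment_divisions 0 a (k - i)) * card (irreducible_divisions 0 (n - a) i))"
  proof (intro sum.cong refl)
    fix a i assume "a \<in> {..<n}"
    then have "a + (n - a) = n" by simp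
    then show "card (segment_divisions 0 a (k - i)) * card (irreducible_divisions a n i) =
      card (segment_divisions 0 a (k - i)) * card (irreducible_divisions 0 (n - a) i)"
      using card_irreducible_divisions_translate[of a "n - a" i] by (simp only:)
  qed
  finally show ?thesis .
qed

section \<open>Irreducible divisions of deficiency 0 and 1\<close>

lemma segment_division_0_eq:
  assumes "P \<in> segment_divisions a b 0"
  shows "P = (\<lambda>x. {x}) ` segment a b"
proof (cases "P = {}")
  case True
  then show ?thesis using assms by (auto simp: segment_divisions_def partition_on_def)
next
  case False
  then obtain B where B: "B \<in> P" by auto
  have part: "partition_on (segment a b) P" using assms by (simp add: segment_divisions_def)
  \<comment> \<open>A vanishing sum of the terms \<open>card C - 1\<close> forces every piece to be
    a single cell.\<close>
  have one: "card C = 1" if "C \<in> P" for C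
    using sum_segment_division[OF assms] that partition_blockD(2,3)[OF part that]
    by (simp add: le_antisym Suc_leI card_gt_0_iff)
  then obtain x where "B = {x}" using B by (meson card_1_singletonE)
  moreover have "x \<in> segment a b" using partition_blockD(1)[OF part B] calculation by simp
  ultimately show ?thesis using partition_singletons_except[OF part B] one by auto
qed

text \<open>One column has no interior gap, so irreducibility is vacuous; deficiency 0 leaves only
  single cells.\<close>

lemma card_irreducible_divisions_1_0: "card (irreducible_divisions 0 1 0) = 1"
proof -
  have "irreducible_divisions 0 1 0 = {(\<lambda>x. {x}) ` segment 0 1}"
  proof (intro equalityI subsetI)
    fix P assume "P \<in> {(\<lambda>x. {x}) ` segment 0 1}"
    then show "P \<in> irreducible_divisions 0 1 0"
      by (auto simp: irreducible_divisions_def segment_divisions_def partition_on_singletons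
        edge_connected_singleton card_image card_segment)
  qed (auto simp: irreducible_divisions_def dest!: segment_division_0_eq)
  then show ?thesis by simp
qed

lemma segment_0_1: "segment 0 1 = {(0, 0), (1, 0)}"
  by (auto simp: segment_def)

lemma card_irreducible_divisions_1_1: "card (irreducible_divisions 0 1 1) = 1"
proof -
  have "irreducible_divisions 0 1 1 = {{segment 0 1}}"
  proof (intro equalityI subsetI)
    fix P assume "P \<in> irreducible_divisions 0 1 1"
    then have part: "partition_on (segment 0 1) P" and "card P = 1"
      by (auto simp: irreducible_divisions_def segment_divisions_def)
    then obtain B where "P = {B}" by (meson card_1_singletonE)
    then show "P \<in> {{segment 0 1}}" using partition_onD1[OF part] by simp
  next
    fix P assume "P \<in> {{segment 0 1}}"
    moreover have "edge_connected (segment 0 1)"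
      unfolding segment_0_1 by (rule edge_connected_doubleton) (simp add: adjacent_def)
    moreover have "partition_on (segment 0 1) {segment 0 1}"
      by (rule partition_on_space) (simp add: segment_def)
    ultimately show "P \<in> irreducible_divisions 0 1 1"
      by (auto simp: irreducible_divisions_def segment_divisions_def)
  qed
  then show ?thesis by simp
qed

lemma segment_0_2: "segment 0 2 = {(0, 0), (1, 0), (0, 1), (1, 1)}"
  by (auto simp: segment_def)

text \<open>The gap must be crossed by a piece containing a horizontal domino, which uses up the
  whole deficiency; the two choices are the rows.\<close>

lemma card_irreducible_divisions_2_1: "card (irreducible_divisions 0 2 1) = 2"
proof -
  define Q :: "nat \<Rightarrow> cell set set" where
    "Q i = insert {(i, 0), (i, 1)} ((\<lambda>x. {x}) ` (segment 0 2 - {(i, 0), (i, 1)}))" for i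
  \<comment> \<open>The explicit lists serve to count the pieces and to tell the two divisions
    apart.\<close>
  have Q0: "Q 0 = {{(0, 0), (0, 1)}, {(1, 0)}, {(1, 1)}}"
    and Q1: "Q 1 = {{(1, 0), (1, 1)}, {(0, 0)}, {(0, 1)}}"
    unfolding Q_def segment_0_2 by (auto simp: insert_Diff_if)
  have "irreducible_divisions 0 2 1 = {Q 0, Q 1}"
  proof (intro equalityI subsetI)
    fix P assume "P \<in> irreducible_divisions 0 2 1"
    then have P: "P \<in> segment_divisions 0 2 1" and "crosses P 1"
      by (auto simp: irreducible_divisions_def)
    then obtain B u v where B: "B \<in> P" "u \<in> B" "v \<in> B" "snd u < 1" "1 \<le> snd v"
      by (auto simp: crosses_def)
    have part: "partition_on (segment 0 2) P" and "edge_connected B"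
      using P B by (auto simp: segment_divisions_def)
    then obtain i where i: "(i, 0) \<in> B" "(i, 1) \<in> B"
      using edge_connected_crossing[of B u v 1] B by auto
    note blk = partition_blockD[OF part]
    have fin: "finite P" and sum: "(card B - 1) + (\<Sum>C\<in>P-{B}. card C - 1) = 1"
      using sum_segment_division[OF P] B(1) by (auto simp: sum.remove)
    have "card {(i, 0::nat), (i, 1)} \<le> card B"
      using i blk[OF B(1)] by (intro card_mono) auto
    then have "card B \<ge> 2" by simp
    with sum have cB: "card B = 2" and "(\<Sum>C\<in>P-{B}. card C - 1) = 0" by linarith+
    then have one: "card C = 1" if "C \<in> P" "C \<noteq> B" for C
      using fin that blk(2,3)[OF that(1)] by (simp add: le_antisym Suc_leI card_gt_0_iff)
    have "B = {(i, 0), (i, 1)}"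
      using i blk(3)[OF B(1)] cB by (intro card_seteq[symmetric]) auto
    have "i < 2" using blk(1)[OF B(1)] i by (auto simp: segment_def)
    then have "i = 0 \<or> i = 1" by linarith
    moreover have "P = Q i"
      using partition_singletons_except[OF part B(1) one] unfolding Q_def \<open>B = {(i, 0), (i, 1)}\<close> .
    ultimately show "P \<in> {Q 0, Q 1}" by blast
  next
    fix P assume "P \<in> {Q 0, Q 1}"
    then obtain i where i: "P = Q i" "i = 0 \<or> i = 1" by blast
    have "partition_on (segment 0 2) (Q i)"
      unfolding Q_def using i(2)
      by (subst partition_on_insert) (auto simp: disjnt_def partition_on_singletons segment_def)
    moreover have "card (Q i) = 3"
    proof -
      have "card (Q 0) = 3" unfolding Q0 by (simp add: doubleton_eq_iff)
      moreover have "card (Q 1) = 3" unfolding Q1 by (simp add: doubleton_eq_iff)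
      ultimately show ?thesis using i(2) by blast
    qed
    moreover have "edge_connected {(i, 0), (i, 1)}"
      by (rule edge_connected_doubleton) (simp add: adjacent_def)
    then have "\<forall>B\<in>Q i. edge_connected B"
      by (auto simp: Q_def edge_connected_singleton)
    moreover have "crosses (Q i) 1"
      by (auto simp: Q_def crosses_def)
    then have "crosses (Q i) g" if "0 < g" "g < 2" for g
    proof -
      have "g = 1" using that by simp
      then show ?thesis using \<open>crosses (Q i) 1\<close> by simp
    qed
    ultimately show "P \<in> irreducible_divisions 0 2 1"
      unfolding i(1) irreducible_divisions_def segment_divisions_def by simp
  qed
  moreover have "Q 0 \<noteq> Q 1" unfolding Q0 Q1 by (auto simp: doubleton_eq_iff)
  ultimately show ?thesis by simp
qed

subsection \<open>The recurrence in the length of the strip\<close>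

text \<open>\<open>m\<close> is the length of the last irreducible part. The bound
  \<open>m \<le> Suc i\<close> makes the range of summation independent of \<open>n\<close>, and
  \<open>k \<le> n\<close> ensures that no such length is cut off. The term with
  \<open>i = 0\<close> and \<open>m = 1\<close> yields the count for \<open>n\<close>; all others
  involve counts of smaller deficiency.\<close>

lemma card_segment_divisions_Suc:
  assumes "k \<le> n"
  shows "card (segment_divisions 0 (Suc n) k) = card (segment_divisions 0 n k) +
    (\<Sum>i=1..k. \<Sum>m=1..Suc i. card (irreducible_divisions 0 m i) * card (segment_divisions 0 (Suc n - m) (k - i)))"
proof -
  let ?t = "\<lambda>m i. card (irreducible_divisions 0 m i) * card (segment_divisions 0 (Suc n - m) (k - i))"
  have "card (segment_divisions 0 (Suc n) k) = (\<Sum>a<Suc n. \<Sum>i\<le>k. ?t (Suc n - a) i)"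
    unfolding card_segment_divisions_rec[OF zero_less_Suc, of n k] by (intro sum.cong refl) simp
  also have "\<dots> = (\<Sum>m=1..Suc n. \<Sum>i\<le>k. ?t m i)"
    by (rule sum.reindex_bij_witness[where i = "\<lambda>m. Suc n - m" and j = "\<lambda>a. Suc n - a"]) auto
  also have "\<dots> = (\<Sum>i\<le>k. \<Sum>m=1..Suc n. ?t m i)"
    by (rule sum.swap)
  also have "\<dots> = (\<Sum>i\<le>k. \<Sum>m=1..Suc i. ?t m i)"
  proof (rule sum.cong[OF refl], rule sum.mono_neutral_right)
    fix i assume i: "i \<in> {..k}"
    then show "{1..Suc i} \<subseteq> {1..Suc n}" using assms by auto
    show "\<forall>m\<in>{1..Suc n} - {1..Suc i}. ?t m i = 0"
    proof
      fix m assume "m \<in> {1..Suc n} - {1..Suc i}"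
      then have "irreducible_divisions 0 m i = {}"
        using irreducible_divisions_length_le[of _ 0 m i] by force
      then show "?t m i = 0" by simp
    qed
  qed simp
  also have "\<dots> = (\<Sum>m=1..Suc 0. ?t m 0) + (\<Sum>i=1..k. \<Sum>m=1..Suc i. ?t m i)"
    by (simp only: atMost_atLeast0 sum.atLeast_Suc_atMost[of 0 k] le0 One_nat_def)
  also have "(\<Sum>m=1..Suc 0. ?t m 0) = card (segment_divisions 0 n k)"
    using card_irreducible_divisions_1_0 by simp
  finally show ?thesis .
qed

lemma segment_divisions_0_0: "segment_divisions 0 0 0 = {{}}"
  by (auto simp: segment_divisions_def segment_def partition_on_empty)

lemma eventually_poly_card_segment_divisions:
  "eventually_poly k (3 ^ k / fact k) (\<lambda>n. real (card (segment_divisions 0 n k)))"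
proof (induction k rule: less_induct)
  case (less k)
  let ?f = "\<lambda>k n. real (card (segment_divisions 0 n k))"
  let ?c = "\<lambda>m i. real (card (irreducible_divisions 0 m i))"
  show ?case
  proof (cases k)
    case 0
    \<comment> \<open>For deficiency 0 the sum in the recurrence is empty, so the count keeps its
      value at the empty strip.\<close>
    have "card (segment_divisions 0 n 0) = 1" for n
      by (induction n) (simp_all add: segment_divisions_0_0 card_segment_divisions_Suc)
    then show ?thesis using 0 by (intro eventually_polyI[of 1]) auto
  next
    case (Suc d)
    \<comment> \<open>\<open>e m i\<close> is the coefficient at degree \<open>d\<close> of one
      term: since \<open>d = k - 1\<close>, only \<open>i = 1\<close> can reach that degree.\<close>
    define e where "e m i = (if i = 1 then ?c m i * (3 ^ d / fact d) else 0)" for m i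
    have "eventually_poly d (e m i) (\<lambda>n. ?c m i * ?f (k - i) (Suc n - m))" if i: "i \<in> {1..k}" for m i
    proof (cases "i = 1")
      case True
      have "eventually_poly d (3 ^ d / fact d) (?f d)"
        by (rule less.IH) (simp add: Suc)
      from eventually_poly_cmult[OF eventually_poly_shift[OF this]] show ?thesis
        using True Suc by (simp add: e_def)
    next
      case False
      have "eventually_poly d 0 (?f (k - i))"
        by (rule eventually_poly_raise[OF less.IH]) (use i False Suc in auto)
      from eventually_poly_cmult[OF eventually_poly_shift[OF this], of "?c m i"] show ?thesis
        using False by (simp add: e_def)
    qed
    then have "eventually_poly d (\<Sum>i=1..k. \<Sum>m=1..Suc i. e m i)
        (\<lambda>n. \<Sum>i=1..k. \<Sum>m=1..Suc i. ?c m i * ?f (k - i) (Suc n - m))"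
      by (intro eventually_poly_sum) auto
    moreover have "(\<Sum>i=1..k. \<Sum>m=1..Suc i. e m i) = 3 * (3 ^ d / fact d)"
    proof -
      have "(\<Sum>i=1..k. \<Sum>m=1..Suc i. e m i) = (\<Sum>i\<in>{1}. \<Sum>m=1..Suc i. e m i)"
        using Suc by (intro sum.mono_neutral_right) (auto simp: e_def)
      \<comment> \<open>Only lengths 1 and 2 occur for \<open>i = 1\<close>; their counts 1 and 2
        add up to the base 3 of the leading coefficient.\<close>
      also have "\<dots> = e 1 1 + e 2 1" by (simp add: numeral_2_eq_2)
      also have "\<dots> = 3 * (3 ^ d / fact d)"
        using card_irreducible_divisions_1_1 card_irreducible_divisions_2_1 by (simp add: e_def)
      finally show ?thesis .
    qed
    ultimately obtain P where P: "degree P \<le> d" "coeff P d = 3 * (3 ^ d / fact d)"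
      and ev: "\<forall>\<^sub>F n in sequentially.
        (\<Sum>i=1..k. \<Sum>m=1..Suc i. ?c m i * ?f (k - i) (Suc n - m)) = poly P (real n)"
      by (auto elim: eventually_polyE)
    \<comment> \<open>The recurrence is available only for \<open>k \<le> n\<close>, which holds
      eventually.\<close>
    from eventually_ge_at_top[of k] ev
    have "\<forall>\<^sub>F n in sequentially. ?f k (Suc n) - ?f k n = poly P (real n)"
    proof eventually_elim
      case (elim n)
      then show ?case using card_segment_divisions_Suc[of k n] by simp
    qed
    then have "eventually_poly d (3 * (3 ^ d / fact d)) (\<lambda>n. ?f k (Suc n) - ?f k n)"
      using P by (rule eventually_polyI[rotated 2])
    then have "eventually_poly (Suc d) (3 * (3 ^ d / fact d) / real (Suc d)) (?f k)"
      by (rule eventually_poly_antidifference)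
    then show ?thesis using Suc by (simp add: field_simps)
  qed
qed

theorem theorem3:
  fixes k :: nat
  shows "\<exists>P :: real poly. degree P = k \<and> lead_coeff P = 3 ^ k / fact k \<and>
           (\<forall>\<^sub>F n in sequentially. real (r (2 * int n - int k) n) = poly P (real n))"
proof -
  obtain P where P: "degree P \<le> k" "coeff P k = 3 ^ k / fact k"
    and ev: "\<forall>\<^sub>F n in sequentially. real (card (segment_divisions 0 n k)) = poly P (real n)"
    using eventually_poly_card_segment_divisions by (rule eventually_polyE)
  \<comment> \<open>A nonzero coefficient at \<open>k\<close> turns the degree bound into the exact
    degree.\<close>
  have "coeff P k \<noteq> 0" using P(2) by simp
  then have "degree P = k" using P(1) le_degree by (metis le_antisym)
  then show ?thesis
    using P(2) ev by (intro exI[of _ P]) (simp add: r_eq_card_segment_divisions)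
qed

end
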